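(* Let $\alpha \in [0,1]$ with $\alpha < \frac{1}{2}$. Then, as $n\to\infty$, \[ \|\sigma_n^\alpha\| \sim C_\alpha\, n^{\frac{1}{2}-\alpha}, \] where \[ C_\alpha := \Gamma(\alpha+1)\frac{\Gamma(1-2\alpha)^{1/2}}{\Gamma(1-\alpha)} \] is a finite positive constant.
   Context: $\Gamma$ is the Gamma function. Generalized binomial coefficients are defined by $\binom{x}{y}:=\frac{\Gamma(x+1)}{\Gamma(y+1)\Gamma(x-y+1)}$ for real $x\ge y>-1$. For an integer $n>1$ and $\alpha\in[0,1]$, put $c_k=c_{k,n}^\alpha=\binom{n+\alpha}{\alpha}^{-1}\binom{n-k+\alpha}{\alpha}$ for $k=0,\ldots,n$ and $c_k=0$ for $k>n$. The generalized Cesàro operator $\sigma_n^\alpha$ acts on a power series $f(z)=\sum_{k\ge0}a_kz^k$ by $(\sigma_n^\alpha f)(z)=\sum_{k=0}^n c_k a_k z^k$. For a sequence $c=(c_k)_{k\ge1}$ of complex numbers, $T_c$ denotes the infinite upper triangular matrix with entries $(T_c)_{ii}=c_i$, $(T_c)_{ij}=c_j-c_{j-1}$ for $j>i\geq 1$, and $(T_c)_{ij}=0$ for $j<i$. The norm is defined by $\|\sigma_n^\alpha\|:=\|T_c\|_{\ell^2\to\ell^2}$, the operator norm on $\ell^2=\ell^2(\{1,2,\ldots\})$ of $T_c$ for the sequence $c=(c_{k,n}^\alpha)_{k\ge1}$ with $c_{k,n}^\alpha=\binom{n+\alpha}{\alpha}^{-1}\binom{n-k+\alpha}{\alpha}$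 for $1\le k\le n$ and $c_{k,n}^\alpha=0$ for $k>n$. Equivalently (known fact), $\|\sigma_n^\alpha\|^2=\sup_f \mathcal{D}_1(\sigma_n^\alpha f)/\mathcal{D}_1(f)$, the supremum being over nonconstant $f$ holomorphic on the open unit disc $\mathbb{D}$ with $\mathcal{D}_1(f):=\int_{\mathbb{D}}\frac{1-|z|^2}{|1-z|^2}|f'(z)|^2\,dA(z)<\infty$, where $dA$ is area measure (its normalization does not affect the quotient). The notation $f(n)\sim g(n)$ means $\lim_{n\to\infty} f(n)/g(n)=1$. *)

theory Defs
  imports "HOL-Analysis.Analysis" "HOL-Library.Landau_Symbols"
begin

definition gbinom :: "real \<Rightarrow> real \<Rightarrow> real" where
  "gbinom x y = Gamma (x + 1) / (Gamma (y + 1) * Gamma (x - y + 1))"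

definition cesaro_coeff :: "real \<Rightarrow> nat \<Rightarrow> nat \<Rightarrow> real" where
  "cesaro_coeff \<alpha> n k =
     (if k \<le> n then inverse (gbinom (real n + \<alpha>) \<alpha>) * gbinom (real n - real k + \<alpha>) \<alpha> else 0)"

text \<open>
  Sequences and matrices over the index set {1, 2, ...} are functions on nat;
  their values at index 0 are irrelevant.
\<close>

definition ell2 :: "(nat \<Rightarrow> complex) set" where
  "ell2 = {x. (\<lambda>k. (cmod (x k))\<^sup>2) summable_on {1..}}"

definition ell2_norm :: "(nat \<Rightarrow> complex) \<Rightarrow> real" where
  "ell2_norm x = sqrt (\<Sum>\<^sub>\<infinity>k\<in>{1..}. (cmod (x k))\<^sup>2)"

definition mat_apply :: "(nat \<Rightarrow> nat \<Rightarrow> complex) \<Rightarrow> (nat \<Rightarrow> complex) \<Rightarrow> nat \<Rightarrow> complex" where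
  "mat_apply A x i = (\<Sum>\<^sub>\<infinity>j\<in>{1..}. A i j * x j)"

text \<open>
  The supremum is taken in the reals, so this is the operator norm only for a matrix that
  defines a bounded operator; \<open>T_matrix_bounded\<close> below shows this for the matrices used here.
\<close>

definition ell2_opnorm :: "(nat \<Rightarrow> nat \<Rightarrow> complex) \<Rightarrow> real" where
  "ell2_opnorm A = (SUP x\<in>{x \<in> ell2. ell2_norm x \<le> 1}. ell2_norm (mat_apply A x))"

definition T_matrix :: "(nat \<Rightarrow> complex) \<Rightarrow> nat \<Rightarrow> nat \<Rightarrow> complex" where
  "T_matrix c i j = (if j = i then c i else if j > i then c j - c (j - 1) else 0)"

definition cesaro_norm :: "real \<Rightarrow> nat \<Rightarrow> real" where
  "cesaro_norm \<alpha> n = ell2_opnorm (T_matrix (\<lambda>k. complex_of_real (cesaro_coeff \<alpha> n k)))"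

definition C_const :: "real \<Rightarrow> real" where
  "C_const \<alpha> = Gamma (\<alpha> + 1) * (Gamma (1 - 2 * \<alpha>) powr (1 / 2) / Gamma (1 - \<alpha>))"

lemma ell2_finite_support:
  assumes "\<And>i. i > n \<Longrightarrow> y i = 0"
  shows "y \<in> ell2" and "ell2_norm y = sqrt (\<Sum>i\<in>{1..n}. (cmod (y i))\<^sup>2)"
proof -
  have "(\<lambda>k. (cmod (y k))\<^sup>2) summable_on {1..} \<longleftrightarrow> (\<lambda>k. (cmod (y k))\<^sup>2) summable_on {1..n}"
    by (rule summable_on_cong_neutral) (use assms in \<open>auto simp: not_le\<close>)
  then show "y \<in> ell2" by (simp add: ell2_def)
  have "(\<Sum>\<^sub>\<infinity>k\<in>{1..}. (cmod (y k))\<^sup>2) = (\<Sum>\<^sub>\<infinity>k\<in>{1..n}. (cmod (y k))\<^sup>2)"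
    by (rule infsum_cong_neutral) (use assms in \<open>auto simp: not_le\<close>)
  then show "ell2_norm y = sqrt (\<Sum>i\<in>{1..n}. (cmod (y i))\<^sup>2)"
    by (simp add: ell2_norm_def)
qed

lemma cmod_le_ell2_norm:
  assumes "x \<in> ell2" "k \<ge> 1"
  shows "cmod (x k) \<le> ell2_norm x"
proof -
  have "(\<Sum>\<^sub>\<infinity>j\<in>{k}. (cmod (x j))\<^sup>2) \<le> (\<Sum>\<^sub>\<infinity>j\<in>{1..}. (cmod (x j))\<^sup>2)"
    by (rule infsum_mono_neutral) (use assms in \<open>auto simp: ell2_def\<close>)
  then show ?thesis
    by (simp add: ell2_norm_def real_le_rsqrt)
qed

lemma T_matrix_bounded:
  assumes c: "\<And>k. k > n \<Longrightarrow> c k = 0"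
  shows "x \<in> ell2 \<Longrightarrow> mat_apply (T_matrix c) x \<in> ell2"
    and "bdd_above ((\<lambda>x. ell2_norm (mat_apply (T_matrix c) x)) ` {x \<in> ell2. ell2_norm x \<le> 1})"
proof -
  have zero: "mat_apply (T_matrix c) x i = 0" if "i > n" for x i
    unfolding mat_apply_def by (rule infsum_0) (use that c in \<open>auto simp: T_matrix_def\<close>)
  show "x \<in> ell2 \<Longrightarrow> mat_apply (T_matrix c) x \<in> ell2"
    by (rule ell2_finite_support[of n]) (rule zero)
  have row: "mat_apply (T_matrix c) x i = (\<Sum>j\<in>{1..Suc n}. T_matrix c i j * x j)"
    if "i \<le> n" for x i
  proof -
    have "mat_apply (T_matrix c) x i = (\<Sum>\<^sub>\<infinity>j\<in>{1..Suc n}. T_matrix c i j * x j)"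
      unfolding mat_apply_def
      by (rule infsum_cong_neutral) (use that c in \<open>auto simp: T_matrix_def not_le\<close>)
    then show ?thesis by simp
  qed
  have "ell2_norm (mat_apply (T_matrix c) x)
      \<le> sqrt (\<Sum>i\<in>{1..n}. (\<Sum>j\<in>{1..Suc n}. cmod (T_matrix c i j))\<^sup>2)"
    if x: "x \<in> ell2" "ell2_norm x \<le> 1" for x
  proof -
    have le: "cmod (mat_apply (T_matrix c) x i) \<le> (\<Sum>j\<in>{1..Suc n}. cmod (T_matrix c i j))"
      if "i \<in> {1..n}" for i
    proof -
      have "cmod (T_matrix c i j * x j) \<le> cmod (T_matrix c i j)" if "j \<in> {1..Suc n}" for j
        using cmod_le_ell2_norm[of x j] x that by (auto simp: norm_mult intro: mult_left_le)
      then have "cmod (\<Sum>j\<in>{1..Suc n}. T_matrix c i j * x j)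
          \<le> (\<Sum>j\<in>{1..Suc n}. cmod (T_matrix c i j))"
        by (rule sum_norm_le)
      then show ?thesis using row[of i x] that by simp
    qed
    have "ell2_norm (mat_apply (T_matrix c) x)
        = sqrt (\<Sum>i\<in>{1..n}. (cmod (mat_apply (T_matrix c) x i))\<^sup>2)"
      by (rule ell2_finite_support(2)) (rule zero)
    then show ?thesis
      by (simp only:) (intro real_sqrt_le_mono sum_mono power_mono le norm_ge_zero)
  qed
  then show "bdd_above ((\<lambda>x. ell2_norm (mat_apply (T_matrix c) x)) ` {x \<in> ell2. ell2_norm x \<le> 1})"
    by (intro bdd_aboveI2) auto
qed

end

(* The Cesaro coefficients satisfy c_j - c_{j-1} = -b_{n+1-j} / A_n with b_m = (alpha)_m / m! and
   A_n = binom(n + alpha, alpha), so up to a diagonal part of norm at most 1 the matrix is the upper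
   triangle of a rank-one matrix. Cauchy-Schwarz bounds its norm by sqrt(n * sum b_m^2) / A_n, and
   testing on the last M + 1 coordinates with M = floor(sqrt n) shows that this is sharp, since
   sum b_m^2 converges exactly for alpha < 1/2. Gauss's theorem for 2F1(alpha, alpha; 1; 1)
   evaluates the sum, by contiguity in the lower parameter. *)

theory Submission
  imports Defs "HOL-Real_Asymp.Real_Asymp"
begin

section \<open>The norm of an upper triangular difference matrix\<close>

lemma ell2_norm_eq_L2_set:
  assumes "\<And>i. i > n \<Longrightarrow> y i = 0"
  shows "ell2_norm y = L2_set (\<lambda>i. cmod (y i)) {1..n}"
  using ell2_finite_support(2)[OF assms] by (simp add: L2_set_def)

lemma L2_set_le_ell2_norm:
  assumes "x \<in> ell2" "J \<subseteq> {1..}" "finite J"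
  shows "L2_set (\<lambda>j. cmod (x j)) J \<le> ell2_norm x"
proof -
  have "(\<Sum>\<^sub>\<infinity>j\<in>J. (cmod (x j))\<^sup>2) \<le> (\<Sum>\<^sub>\<infinity>j\<in>{1..}. (cmod (x j))\<^sup>2)"
    by (rule infsum_mono_neutral) (use assms in \<open>auto simp: ell2_def\<close>)
  then show ?thesis
    using assms by (simp add: ell2_norm_def L2_set_def)
qed

text \<open>The sum ends at \<open>Suc n\<close>, not \<open>n\<close>: \<open>c (Suc n)\<close> is
  zero but \<open>c n\<close> need not be, so column \<open>Suc n\<close> still holds the entry
  \<open>- c n\<close>. All later columns vanish.\<close>

lemma mat_apply_T_matrix:
  assumes c: "\<And>k. k > n \<Longrightarrow> c k = 0" and "i \<ge> 1"
  shows "mat_apply (T_matrix c) x i = c i * x i + (\<Sum>j\<in>{Suc i..Suc n}. (c j - c (j - 1)) * x j)"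
proof -
  have "mat_apply (T_matrix c) x i = (\<Sum>\<^sub>\<infinity>j\<in>insert i {Suc i..Suc n}. T_matrix c i j * x j)"
    unfolding mat_apply_def
    by (rule infsum_cong_neutral) (use \<open>i \<ge> 1\<close> c in \<open>auto simp: T_matrix_def not_le\<close>)
  also have "\<dots> = T_matrix c i i * x i + (\<Sum>j\<in>{Suc i..Suc n}. T_matrix c i j * x j)"
    by simp
  also have "(\<Sum>j\<in>{Suc i..Suc n}. T_matrix c i j * x j)
      = (\<Sum>j\<in>{Suc i..Suc n}. (c j - c (j - 1)) * x j)"
    by (rule sum.cong) (auto simp: T_matrix_def)
  also have "T_matrix c i i = c i"
    by (simp add: T_matrix_def)
  finally show ?thesis .
qed

text \<open>The diagonal part contributes at most \<open>K\<close>. Above the diagonal an entry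
  depends on its column only, so Cauchy-Schwarz gives one bound for all \<open>n\<close> nonzero
  rows; Minkowski's inequality adds the two parts.\<close>

lemma ell2_opnorm_T_matrix_le:
  assumes c: "\<And>k. k > n \<Longrightarrow> c k = 0" and K: "\<And>k. cmod (c k) \<le> K"
  shows "ell2_opnorm (T_matrix c)
    \<le> K + sqrt (real n * (\<Sum>j\<in>{1..Suc n}. (cmod (c j - c (j - 1)))\<^sup>2))"
proof -
  define w where "w j = cmod (c j - c (j - 1))" for j
  define W where "W = L2_set w {1..Suc n}"
  have "K \<ge> 0" using K[of 0] norm_ge_zero order_trans by blast
  have "ell2_norm (mat_apply (T_matrix c) x) \<le> K + sqrt (real n) * W"
    if x: "x \<in> ell2" "ell2_norm x \<le> 1" for x
  proof -
    have x1: "L2_set (\<lambda>j. cmod (x j)) J \<le> 1" if "J \<subseteq> {1..}" "finite J" for J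
      using L2_set_le_ell2_norm[OF x(1) that] x(2) by simp
    have row: "cmod (mat_apply (T_matrix c) x i) \<le> K * cmod (x i) + W" if "i \<in> {1..n}" for i
    proof -
      have "cmod (\<Sum>j\<in>{Suc i..Suc n}. (c j - c (j - 1)) * x j)
          \<le> (\<Sum>j\<in>{Suc i..Suc n}. \<bar>w j\<bar> * \<bar>cmod (x j)\<bar>)"
        by (rule sum_norm_le) (simp add: norm_mult w_def)
      \<comment> \<open>Passing to all columns makes the bound independent of the row
        \<open>i\<close>.\<close>
      also have "\<dots> \<le> (\<Sum>j\<in>{1..Suc n}. \<bar>w j\<bar> * \<bar>cmod (x j)\<bar>)"
        by (rule sum_mono2) auto
      also have "\<dots> \<le> W * L2_set (\<lambda>j. cmod (x j)) {1..Suc n}"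
        unfolding W_def by (rule L2_set_mult_ineq)
      also have "\<dots> \<le> W * 1"
        by (intro mult_left_mono x1) (auto simp: W_def)
      finally have "cmod (\<Sum>j\<in>{Suc i..Suc n}. (c j - c (j - 1)) * x j) \<le> W" by simp
      moreover have "cmod (c i * x i) \<le> K * cmod (x i)"
        by (simp add: norm_mult mult_right_mono K)
      moreover have "mat_apply (T_matrix c) x i
          = c i * x i + (\<Sum>j\<in>{Suc i..Suc n}. (c j - c (j - 1)) * x j)"
        using that by (intro mat_apply_T_matrix c) auto
      ultimately show ?thesis
        by (smt (verit) norm_triangle_ineq)
    qed
    have "mat_apply (T_matrix c) x i = 0" if "i > n" for i
      unfolding mat_apply_def by (rule infsum_0) (use that c in \<open>auto simp: T_matrix_def\<close>)
    then have "ell2_norm (mat_apply (T_matrix c) x)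
        = L2_set (\<lambda>i. cmod (mat_apply (T_matrix c) x i)) {1..n}"
      by (rule ell2_norm_eq_L2_set)
    also have "\<dots> \<le> L2_set (\<lambda>i. K * cmod (x i) + W) {1..n}"
      by (intro L2_set_mono row) auto
    also have "\<dots> \<le> L2_set (\<lambda>i. K * cmod (x i)) {1..n} + L2_set (\<lambda>i. W) {1..n}"
      by (rule L2_set_triangle_ineq)
    also have "\<dots> = K * L2_set (\<lambda>i. cmod (x i)) {1..n} + sqrt (real n) * W"
      using \<open>K \<ge> 0\<close> by (simp add: L2_set_right_distrib L2_set_constant W_def)
    also have "\<dots> \<le> K * 1 + sqrt (real n) * W"
      using \<open>K \<ge> 0\<close> by (intro add_right_mono mult_left_mono x1) auto
    finally show ?thesis by simp
  qed
  moreover have "(\<lambda>k. 0) \<in> {x \<in> ell2. ell2_norm x \<le> 1}"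
    by (simp add: ell2_def ell2_norm_def)
  ultimately have "ell2_opnorm (T_matrix c) \<le> K + sqrt (real n) * W"
    unfolding ell2_opnorm_def by (intro cSUP_least) auto
  then show ?thesis
    by (simp add: W_def L2_set_def w_def real_sqrt_mult)
qed

text \<open>On sequences supported beyond \<open>m\<close>, the first \<open>m\<close> rows of \<open>T_matrix c\<close> are the same linear
  functional; we test on the sequence representing that functional.\<close>

lemma ell2_opnorm_T_matrix_ge:
  assumes c: "\<And>k. k > n \<Longrightarrow> c k = 0" and "m \<le> n"
  shows "sqrt (real m * (\<Sum>j\<in>{Suc m..Suc n}. (cmod (c j - c (j - 1)))\<^sup>2))
    \<le> ell2_opnorm (T_matrix c)"
proof -
  define V where "V = (\<Sum>j\<in>{Suc m..Suc n}. (cmod (c j - c (j - 1)))\<^sup>2)"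
  \<comment> \<open>The normalised conjugate of the common row is the equality case of
    Cauchy-Schwarz. If \<open>V = 0\<close>, division by zero makes \<open>x\<close> the zero
    sequence and the argument still goes through.\<close>
  define x where "x j = (if j \<in> {Suc m..Suc n}
    then cnj (c j - c (j - 1)) / of_real (sqrt V) else 0)" for j
  have "V \<ge> 0" by (simp add: V_def sum_nonneg)
  have x_ell2: "x \<in> ell2"
    by (rule ell2_finite_support[of "Suc n"]) (auto simp: x_def)
  have "ell2_norm x = sqrt (\<Sum>j\<in>{1..Suc n}. (cmod (x j))\<^sup>2)"
    by (rule ell2_finite_support[of "Suc n"]) (auto simp: x_def)
  also have "(\<Sum>j\<in>{1..Suc n}. (cmod (x j))\<^sup>2) = (\<Sum>j\<in>{Suc m..Suc n}. (cmod (x j))\<^sup>2)"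
    by (rule sum.mono_neutral_right) (auto simp: x_def)
  also have "\<dots> = (\<Sum>j\<in>{Suc m..Suc n}. (cmod (c j - c (j - 1)))\<^sup>2 / V)"
    by (rule sum.cong)
      (use \<open>V \<ge> 0\<close> in \<open>auto simp: x_def norm_divide power_divide simp del: complex_cnj_diff\<close>)
  \<comment> \<open>This quotient is 1, or 0 when \<open>V = 0\<close>; hence the norm is only
    claimed to be at most 1.\<close>
  also have "\<dots> = V / V"
    by (simp only: V_def flip: sum_divide_distrib)
  finally have x_norm: "ell2_norm x \<le> 1"
    by simp
  have row: "mat_apply (T_matrix c) x i = of_real (sqrt V)" if "i \<in> {1..m}" for i
  proof -
    have "mat_apply (T_matrix c) x i
        = c i * x i + (\<Sum>j\<in>{Suc i..Suc n}. (c j - c (j - 1)) * x j)"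
      using that by (intro mat_apply_T_matrix c) auto
    also have "x i = 0" using that by (simp add: x_def)
    also have "(\<Sum>j\<in>{Suc i..Suc n}. (c j - c (j - 1)) * x j)
        = (\<Sum>j\<in>{Suc m..Suc n}. (c j - c (j - 1)) * x j)"
      by (rule sum.mono_neutral_right) (use that in \<open>auto simp: x_def\<close>)
    also have "\<dots> = (\<Sum>j\<in>{Suc m..Suc n}. of_real ((cmod (c j - c (j - 1)))\<^sup>2) / of_real (sqrt V))"
      by (rule sum.cong)
        (auto simp: x_def complex_norm_square simp del: complex_cnj_diff of_real_power)
    also have "\<dots> = of_real V / of_real (sqrt V)"
      by (simp only: V_def of_real_sum flip: sum_divide_distrib)
    also have "\<dots> = of_real (V / sqrt V)"
      by simp
    also have "V / sqrt V = sqrt V"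
      using \<open>V \<ge> 0\<close> by (simp add: real_div_sqrt)
    finally show ?thesis by simp
  qed
  have "sqrt (real m * V) = L2_set (\<lambda>i. sqrt V) {1..m}"
    using \<open>V \<ge> 0\<close> by (simp add: L2_set_constant real_sqrt_mult)
  also have "\<dots> = L2_set (\<lambda>i. cmod (mat_apply (T_matrix c) x i)) {1..m}"
    by (intro L2_set_cong) (use row \<open>V \<ge> 0\<close> in auto)
  also have "\<dots> \<le> ell2_norm (mat_apply (T_matrix c) x)"
    by (rule L2_set_le_ell2_norm[OF T_matrix_bounded(1)[OF c x_ell2]]) auto
  also have "\<dots> \<le> ell2_opnorm (T_matrix c)"
    unfolding ell2_opnorm_def
    by (rule cSUP_upper[OF _ T_matrix_bounded(2)[OF c]]) (use x_ell2 x_norm in auto)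
  finally show ?thesis by (simp add: V_def)
qed


section \<open>Gauss's summation of a hypergeometric series\<close>

text \<open>The terms of the hypergeometric series 2F1(a, a; c; 1). The value sought is at c = 1;
  the lower parameter is kept free so that it can be shifted to infinity.\<close>

definition gauss_term :: "real \<Rightarrow> real \<Rightarrow> nat \<Rightarrow> real" where
  "gauss_term a c m = (pochhammer a m)\<^sup>2 / (pochhammer c m * fact m)"

section \<open>Growth of Pochhammer symbols and decay of the series terms\<close>

lemma rGamma_series_pochhammer:
  fixes z :: real
  assumes "n > 0" "z + real n \<noteq> 0"
  shows "pochhammer z n / fact n = rGamma_series z n * real n powr z / (z + real n)"
  using assms
  by (simp add: rGamma_series_def pochhammer_Suc powr_def divide_simps)

text \<open>Euler's limit for 1/Gamma. It governs both the decay of the series terms and the growth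
  of the binomials; \<open>rGamma\<close> also covers the poles of Gamma, such as z = 0, which
  occurs for \<alpha> = 0.\<close>

lemma pochhammer_over_fact_LIMSEQ:
  fixes z :: real
  shows "(\<lambda>n. pochhammer z n / fact n * real n powr (1 - z)) \<longlonglongrightarrow> rGamma z"
proof -
  have "(\<lambda>n. rGamma_series z n * (real n / (z + real n))) \<longlonglongrightarrow> rGamma z * 1"
    by (intro tendsto_intros; real_asymp)
  moreover have "\<forall>\<^sub>F n in sequentially. z + real n > 0"
    by real_asymp
  then have "\<forall>\<^sub>F n in sequentially. rGamma_series z n * (real n / (z + real n))
      = pochhammer z n / fact n * real n powr (1 - z)"
    using eventually_gt_at_top[of 0]
  proof eventually_elim
    case (elim n)
    have "real n powr z * real n powr (1 - z) = real n"
      using elim by (simp flip: powr_add)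
    then show ?case
      using elim by (simp add: rGamma_series_pochhammer mult_ac divide_simps)
  qed
  ultimately show ?thesis
    using Lim_transform_eventually by fastforce
qed

lemma gauss_term_nonneg: "c > 0 \<Longrightarrow> gauss_term a c m \<ge> 0"
  by (simp add: gauss_term_def pochhammer_nonneg)

lemma gauss_term_one: "gauss_term a 1 m = (pochhammer a m / fact m)\<^sup>2"
  by (simp add: gauss_term_def pochhammer_fact[symmetric] power2_eq_square)

text \<open>The terms are O(m^(2a - 2)), and this exponent is below -1 exactly when a < 1/2.\<close>

lemma summable_gauss_term_one:
  assumes "a < 1 / 2"
  shows "summable (gauss_term a 1)"
proof (rule summable_comparison_test_bigo)
  show "summable (\<lambda>m. norm (real m powr (2 * a - 2)))"
    using assms by (simp add: summable_real_powr_iff)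
  have "(\<lambda>m. pochhammer a m / fact m) \<in> O(\<lambda>m. real m powr (a - 1))"
  proof (rule bigoI_tendsto)
    show "(\<lambda>m. pochhammer a m / fact m / real m powr (a - 1)) \<longlonglongrightarrow> rGamma a"
      using pochhammer_over_fact_LIMSEQ[of a] by (simp add: powr_diff field_simps)
  qed (use eventually_gt_at_top[of 0] in eventually_elim, simp)
  then have "(\<lambda>m. (pochhammer a m / fact m)\<^sup>2) \<in> O(\<lambda>m. (real m powr (a - 1))\<^sup>2)"
    by (rule landau_o.big_power)
  moreover have "(real m powr (a - 1))\<^sup>2 = real m powr (2 * a - 2)" for m
    by (simp add: power2_eq_square flip: powr_add)
  ultimately show "gauss_term a 1 \<in> O(\<lambda>m. real m powr (2 * a - 2))"
    by (simp add: gauss_term_one[abs_def])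
qed

text \<open>This makes the boundary term at infinity vanish in the telescoping sum of
  \<open>gauss_contiguity\<close>. The product is a convergent square times m^(2a - 1), whose
  exponent is negative.\<close>

lemma gauss_term_one_times_LIMSEQ:
  assumes "a < 1 / 2"
  shows "(\<lambda>m. real m * gauss_term a 1 m) \<longlonglongrightarrow> 0"
proof -
  have "(\<lambda>m. (pochhammer a m / fact m * real m powr (1 - a))\<^sup>2 * real m powr (2 * a - 1))
      \<longlonglongrightarrow> (rGamma a)\<^sup>2 * 0"
    using assms by (intro tendsto_intros pochhammer_over_fact_LIMSEQ; real_asymp)
  moreover have "(pochhammer a m / fact m * real m powr (1 - a))\<^sup>2 * real m powr (2 * a - 1)
      = real m * gauss_term a 1 m" if "m > 0" for m
  proof -
    have "(real m powr (1 - a))\<^sup>2 * real m powr (2 * a - 1) = real m"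
      using that by (simp add: power2_eq_square flip: powr_add)
    then show ?thesis
      by (simp only: gauss_term_one power_mult_distrib mult.assoc) (simp only: mult.commute)
  qed
  then have "\<forall>\<^sub>F m in sequentially.
      (pochhammer a m / fact m * real m powr (1 - a))\<^sup>2 * real m powr (2 * a - 1)
      = real m * gauss_term a 1 m"
    using eventually_gt_at_top[of 0] by (rule eventually_mono[rotated])
  ultimately show ?thesis
    using Lim_transform_eventually by fastforce
qed

text \<open>Both bounds compare the factors c + i with 1 + i; the second keeps the first factor c
  intact, which gains the decay 1/c in \<open>gauss_term_le\<close>.\<close>

lemma pochhammer_ge:
  fixes c :: real
  assumes "c \<ge> 1"
  shows "fact m \<le> pochhammer c m" and "m > 0 \<Longrightarrow> c * fact m \<le> pochhammer c m"
proof -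
  show "fact m \<le> pochhammer c m"
    unfolding pochhammer_fact pochhammer_prod by (rule prod_mono) (use assms in auto)
  show "c * fact m \<le> pochhammer c m" if "m > 0"
    using that
  proof (induction m rule: nat_induct_non_zero)
    case (Suc m)
    have "c * fact m * (1 + real m) \<le> pochhammer c m * (c + real m)"
      using Suc assms by (intro mult_mono) (auto intro!: pochhammer_nonneg)
    then show ?case by (simp add: pochhammer_Suc algebra_simps)
  qed simp
qed

lemma gauss_term_le:
  assumes "c \<ge> 1"
  shows "gauss_term a c m \<le> gauss_term a 1 m"
    and "m > 0 \<Longrightarrow> gauss_term a c m \<le> gauss_term a 1 m / c"
proof -
  show "gauss_term a c m \<le> gauss_term a 1 m"
    unfolding gauss_term_def pochhammer_fact[symmetric]
    using pochhammer_ge(1)[OF assms, of m] pochhammer_pos[of c m] assms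
    by (intro divide_left_mono mult_right_mono) auto
  assume "m > 0"
  then show "gauss_term a c m \<le> gauss_term a 1 m / c"
    unfolding gauss_term_def pochhammer_fact[symmetric] divide_divide_eq_left
    using pochhammer_ge(2)[OF assms, of m] assms
    by (intro divide_left_mono) (auto intro!: mult_right_mono mult_pos_pos simp: mult_ac pochhammer_pos)
qed

section \<open>Contiguity in the lower parameter and the value of the sum\<close>

lemma summable_gauss_term:
  assumes "a < 1 / 2" "c \<ge> 1"
  shows "summable (gauss_term a c)"
  by (rule summable_comparison_test'[OF summable_gauss_term_one[OF assms(1)], of 0])
    (use assms in \<open>auto intro!: gauss_term_le simp: gauss_term_nonneg\<close>)

text \<open>The defect of the contiguity relation between individual terms telescopes: it is
  \<open>G m - G (m + 1)\<close> for \<open>G m = c m u m\<close>, where \<open>u m\<close> is the \<open>m\<close>-th term.\<close>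

lemma gauss_contiguity:
  assumes "a < 1 / 2" "c \<ge> 1"
  shows "c * (c - 2 * a) * suminf (gauss_term a c) = (c - a)\<^sup>2 * suminf (gauss_term a (c + 1))"
proof -
  define G where "G m = c * (real m * gauss_term a c m)" for m
  have G: "G m - G (Suc m) = c * (c - 2 * a) * gauss_term a c m - (c - a)\<^sup>2 * gauss_term a (c + 1) m"
    for m
  proof -
    have pos: "pochhammer c m > 0" "c + real m > 0"
      using assms by (auto intro: pochhammer_pos)
    \<comment> \<open>Both sides are \<open>pochhammer c (Suc m)\<close>, with the first or the last
      factor split off.\<close>
    have "c * pochhammer (c + 1) m = pochhammer c m * (c + real m)"
      using pochhammer_rec[of c m] pochhammer_Suc[of c m] by simp
    then have "pochhammer (c + 1) m = pochhammer c m * (c + real m) / c"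
      using assms by (simp add: field_simps)
    then have shift: "gauss_term a (c + 1) m = gauss_term a c m * c / (c + real m)"
      using assms by (simp add: gauss_term_def)
    have "real (Suc m) * gauss_term a c (Suc m) = gauss_term a c m * (a + real m)\<^sup>2 / (c + real m)"
      using pos by (simp add: gauss_term_def pochhammer_Suc power_mult_distrib divide_simps)
    then have "G m - G (Suc m) = gauss_term a c m * (c * real m - c * (a + real m)\<^sup>2 / (c + real m))"
      by (simp add: G_def algebra_simps)
    \<comment> \<open>Multiplied by c + m, both sides become c (c m - 2 a m - a^2): the terms in m^2
      cancel.\<close>
    also have "c * real m - c * (a + real m)\<^sup>2 / (c + real m)
        = c * (c - 2 * a) - (c - a)\<^sup>2 * c / (c + real m)"
      using pos by (simp add: divide_simps) (simp add: algebra_simps power2_eq_square)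
    finally show ?thesis
      unfolding shift by (simp add: algebra_simps)
  qed
  have "(\<lambda>m. real m * gauss_term a c m) \<longlonglongrightarrow> 0"
  proof (rule Lim_null_comparison[OF _ gauss_term_one_times_LIMSEQ[OF assms(1)]])
    show "\<forall>\<^sub>F m in sequentially. norm (real m * gauss_term a c m) \<le> real m * gauss_term a 1 m"
      using assms by (intro always_eventually)
        (auto simp: gauss_term_nonneg intro!: mult_left_mono gauss_term_le)
  qed
  then have "G \<longlonglongrightarrow> c * 0"
    unfolding G_def by (intro tendsto_intros)
  \<comment> \<open>\<open>G 0 = 0\<close> because of the factor m, and \<open>G\<close> tends to 0,
    so the defects sum to 0.\<close>
  from telescope_sums'[OF this]
  have "(\<lambda>m. c * (c - 2 * a) * gauss_term a c m - (c - a)\<^sup>2 * gauss_term a (c + 1) m) sums 0"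
    unfolding G by (simp add: G_def)
  moreover have "(\<lambda>m. c * (c - 2 * a) * gauss_term a c m - (c - a)\<^sup>2 * gauss_term a (c + 1) m) sums
      (c * (c - 2 * a) * suminf (gauss_term a c) - (c - a)\<^sup>2 * suminf (gauss_term a (c + 1)))"
    using assms by (intro sums_diff sums_mult summable_sums summable_gauss_term) auto
  ultimately show ?thesis
    using sums_unique2 by fastforce
qed

text \<open>The zeroth term is always 1 and the rest is squeezed between 0 and S/c. The shift
  \<open>N + 2\<close> is the one that arises in \<open>suminf_gauss_term_one\<close>.\<close>

lemma suminf_gauss_term_LIMSEQ:
  assumes "a < 1 / 2"
  shows "(\<lambda>N. suminf (gauss_term a (real (N + 2)))) \<longlonglongrightarrow> 1"
proof -
  define S where "S = (\<Sum>m. gauss_term a 1 (Suc m))"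
  have bounds: "1 \<le> suminf (gauss_term a c)" "suminf (gauss_term a c) \<le> 1 + S / c" if "c \<ge> 1" for c
  proof -
    have sm: "summable (gauss_term a c)" and sm1: "summable (\<lambda>m. gauss_term a 1 (Suc m))"
      using summable_gauss_term[OF assms that] summable_gauss_term_one[OF assms]
      by (simp_all add: summable_Suc_iff)
    have split: "suminf (gauss_term a c) = 1 + (\<Sum>m. gauss_term a c (Suc m))"
      using suminf_split_head[OF sm] by (simp add: gauss_term_def)
    have "(\<Sum>m. gauss_term a c (Suc m)) \<le> (\<Sum>m. gauss_term a 1 (Suc m) / c)"
      by (intro suminf_le gauss_term_le summable_divide sm1)
        (use sm that in \<open>auto simp: summable_Suc_iff\<close>)
    then show "suminf (gauss_term a c) \<le> 1 + S / c"
      using split suminf_divide[OF sm1, of c] by (simp add: S_def)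
    have "(\<Sum>m. gauss_term a c (Suc m)) \<ge> 0"
      by (intro suminf_nonneg) (use sm that in \<open>auto simp: summable_Suc_iff gauss_term_nonneg\<close>)
    then show "1 \<le> suminf (gauss_term a c)" using split by simp
  qed
  have "(\<lambda>N. 1 + S / real (N + 2)) \<longlonglongrightarrow> 1"
    by real_asymp
  then show ?thesis
    by (rule tendsto_sandwich[OF _ _ tendsto_const, rotated -1])
      (auto intro!: always_eventually bounds)
qed

text \<open>Contiguity applied at c = 1, ..., N: the factors c, c - 2a and c - a accumulate to the
  three Pochhammer symbols.\<close>

lemma suminf_gauss_term_one_eq:
  assumes "a < 1 / 2"
  shows "suminf (gauss_term a 1) * (pochhammer 1 N * pochhammer (1 - 2 * a) N)
    = (pochhammer (1 - a) N)\<^sup>2 * suminf (gauss_term a (real (N + 1)))"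
proof (induction N)
  case (Suc N)
  define c where "c = real (N + 1)"
  have "suminf (gauss_term a 1) * (pochhammer 1 (Suc N) * pochhammer (1 - 2 * a) (Suc N))
      = suminf (gauss_term a 1) * (pochhammer 1 N * pochhammer (1 - 2 * a) N) * (c * (c - 2 * a))"
    by (simp add: pochhammer_Suc c_def algebra_simps)
  also have "\<dots> = (pochhammer (1 - a) N)\<^sup>2 * (c * (c - 2 * a) * suminf (gauss_term a c))"
    by (simp only: Suc.IH c_def) (simp only: mult_ac)
  also have "\<dots> = (pochhammer (1 - a) N * (c - a))\<^sup>2 * suminf (gauss_term a (c + 1))"
    using gauss_contiguity[OF assms, of c] by (simp add: c_def power_mult_distrib)
  also have "pochhammer (1 - a) N * (c - a) = pochhammer (1 - a) (Suc N)"
    by (simp add: pochhammer_Suc c_def algebra_simps)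
  also have "c + 1 = real (Suc N + 1)" by (simp add: c_def)
  finally show ?case .
qed (simp add: gauss_term_def)

text \<open>After normalisation the iterated contiguity relation tends to a relation between values
  of 1/Gamma, since the shifted series tends to 1.\<close>

lemma suminf_gauss_term_one:
  assumes "a < 1 / 2"
  shows "suminf (gauss_term a 1) = Gamma (1 - 2 * a) / (Gamma (1 - a))\<^sup>2"
proof -
  have eq: "suminf (gauss_term a 1) * (rGamma_series 1 N * rGamma_series (1 - 2 * a) N)
      = (rGamma_series (1 - a) N)\<^sup>2 * suminf (gauss_term a (real (N + 2)))" if "N > 0" for N
  proof -
    \<comment> \<open>One normalisation serves both sides because 1 + (1 - 2a) = 2 (1 - a).\<close>
    define E where "E = (fact N * exp ((1 - a) * ln (real N)))\<^sup>2"
    have E: "fact N * exp (ln (real N)) * (fact N * exp ((1 - 2 * a) * ln (real N))) = E"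
      by (simp add: E_def power2_eq_square algebra_simps flip: exp_add)
    have "suminf (gauss_term a 1) * (rGamma_series 1 N * rGamma_series (1 - 2 * a) N)
        = suminf (gauss_term a 1) * (pochhammer 1 (N + 1) * pochhammer (1 - 2 * a) (N + 1)) / E"
      by (simp add: rGamma_series_def flip: E)
    \<comment> \<open>The instance is \<open>N + 1\<close> because \<open>rGamma_series z N\<close>
      contains N + 1 factors.\<close>
    also have "\<dots> = (pochhammer (1 - a) (N + 1))\<^sup>2 * suminf (gauss_term a (real (N + 2))) / E"
      using suminf_gauss_term_one_eq[OF assms, of "N + 1"] by simp
    also have "\<dots> = (rGamma_series (1 - a) N)\<^sup>2 * suminf (gauss_term a (real (N + 2)))"
      by (simp add: rGamma_series_def E_def power_divide)
    finally show ?thesis .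
  qed
  have "(\<lambda>N. suminf (gauss_term a 1) * (rGamma_series 1 N * rGamma_series (1 - 2 * a) N))
      \<longlonglongrightarrow> suminf (gauss_term a 1) * (rGamma 1 * rGamma (1 - 2 * a))"
    by (intro tendsto_intros)
  moreover have "(\<lambda>N. (rGamma_series (1 - a) N)\<^sup>2 * suminf (gauss_term a (real (N + 2))))
      \<longlonglongrightarrow> (rGamma (1 - a))\<^sup>2 * 1"
    by (intro tendsto_intros suminf_gauss_term_LIMSEQ assms)
  then have "(\<lambda>N. suminf (gauss_term a 1) * (rGamma_series 1 N * rGamma_series (1 - 2 * a) N))
      \<longlonglongrightarrow> (rGamma (1 - a))\<^sup>2 * 1"
    by (rule Lim_transform_eventually)
      (use eventually_gt_at_top[of 0] in eventually_elim, simp add: eq)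
  ultimately have "suminf (gauss_term a 1) * (rGamma 1 * rGamma (1 - 2 * a)) = (rGamma (1 - a))\<^sup>2"
    using LIMSEQ_unique by fastforce
  moreover have "Gamma (1 - 2 * a) > 0" "Gamma (1 - a) > 0"
    using assms by (auto intro: Gamma_real_pos)
  ultimately show ?thesis
    by (simp add: rGamma_inverse_Gamma field_simps)
qed


section \<open>The Cesaro coefficients\<close>

lemma gbinom_pochhammer:
  assumes "\<alpha> \<ge> 0"
  shows "gbinom (real m + \<alpha>) \<alpha> = pochhammer (\<alpha> + 1) m / fact m"
proof -
  have "\<alpha> + 1 \<notin> \<int>\<^sub>\<le>\<^sub>0" using assms by (auto dest: nonpos_Ints_nonpos)
  then show ?thesis
    using pochhammer_Gamma[of "\<alpha> + 1" m] Gamma_fact[of m, where ?'a = real]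
    by (simp add: gbinom_def add_ac)
qed

text \<open>Pascal's rule. The Pochhammer form also covers \<alpha> = 0, where both sides
  vanish.\<close>

lemma gbinom_Suc_diff:
  assumes "\<alpha> \<ge> 0"
  shows "gbinom (real (Suc m) + \<alpha>) \<alpha> - gbinom (real m + \<alpha>) \<alpha> = pochhammer \<alpha> (Suc m) / fact (Suc m)"
proof -
  have "pochhammer \<alpha> (Suc m) = \<alpha> * pochhammer (\<alpha> + 1) m"
    by (rule pochhammer_rec)
  then show ?thesis
    unfolding gbinom_pochhammer[OF assms] pochhammer_Suc[of "\<alpha> + 1"]
    by (simp add: divide_simps) (simp add: algebra_simps)
qed

lemma gbinom_pos: "\<alpha> \<ge> 0 \<Longrightarrow> gbinom (real m + \<alpha>) \<alpha> > 0"
  by (simp add: gbinom_pochhammer pochhammer_pos)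

lemma gbinom_mono:
  assumes "\<alpha> \<ge> 0" "m \<le> n"
  shows "gbinom (real m + \<alpha>) \<alpha> \<le> gbinom (real n + \<alpha>) \<alpha>"
proof -
  have "gbinom (real k + \<alpha>) \<alpha> \<le> gbinom (real (Suc k) + \<alpha>) \<alpha>" for k
  proof -
    have "pochhammer \<alpha> (Suc k) / fact (Suc k) \<ge> 0"
      unfolding pochhammer_rec using assms by (auto intro!: divide_nonneg_nonneg mult_nonneg_nonneg pochhammer_nonneg)
    then show ?thesis
      using gbinom_Suc_diff[OF assms(1), of k] by linarith
  qed
  then have "incseq (\<lambda>k. gbinom (real k + \<alpha>) \<alpha>)" by (rule incseq_SucI)
  then show ?thesis using assms(2) by (rule incseqD)
qed

lemma cesaro_coeff_le_one:
  assumes "\<alpha> \<ge> 0"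
  shows "\<bar>cesaro_coeff \<alpha> n k\<bar> \<le> 1"
proof (cases "k \<le> n")
  case True
  then have "cesaro_coeff \<alpha> n k = gbinom (real (n - k) + \<alpha>) \<alpha> / gbinom (real n + \<alpha>) \<alpha>"
    by (simp add: cesaro_coeff_def of_nat_diff field_simps)
  then show ?thesis
    using gbinom_pos[OF assms, of n] gbinom_pos[OF assms, of "n - k"]
      gbinom_mono[OF assms, of "n - k" n]
    by simp
qed (simp add: cesaro_coeff_def)

text \<open>Counting columns backwards from n + 1 makes the numerator independent of n, by Pascal's
  rule.\<close>

lemma cesaro_coeff_diff:
  assumes "\<alpha> \<ge> 0" "m \<le> n"
  shows "cesaro_coeff \<alpha> n (Suc n - m) - cesaro_coeff \<alpha> n (n - m)
    = - (pochhammer \<alpha> m / fact m) / gbinom (real n + \<alpha>) \<alpha>"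
proof (cases m)
  \<comment> \<open>Here the first coefficient lies beyond n and is zero by definition, so the
    difference is minus the last coefficient.\<close>
  case 0
  have "gbinom \<alpha> \<alpha> = 1" using gbinom_pochhammer[OF assms(1), of 0] by simp
  then show ?thesis using 0 by (simp add: cesaro_coeff_def field_simps)
next
  case (Suc p)
  have "cesaro_coeff \<alpha> n (Suc n - m) = gbinom (real p + \<alpha>) \<alpha> / gbinom (real n + \<alpha>) \<alpha>"
    using assms Suc by (simp add: cesaro_coeff_def of_nat_diff field_simps)
  moreover have "cesaro_coeff \<alpha> n (n - m) = gbinom (real (Suc p) + \<alpha>) \<alpha> / gbinom (real n + \<alpha>) \<alpha>"
    using assms Suc by (simp add: cesaro_coeff_def of_nat_diff field_simps)
  ultimately show ?thesis
    unfolding Suc gbinom_Suc_diff[OF assms(1), of p, symmetric]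
    by (simp only: minus_diff_eq diff_divide_distrib)
qed

text \<open>Reversing the order of the columns turns the last n - m + 1 of them into an initial
  segment of the Gauss series.\<close>

lemma sum_cesaro_coeff_diff:
  assumes "\<alpha> \<ge> 0" "m \<le> n"
  shows "(\<Sum>j\<in>{Suc m..Suc n}. (cmod (complex_of_real (cesaro_coeff \<alpha> n j)
      - complex_of_real (cesaro_coeff \<alpha> n (j - 1))))\<^sup>2)
    = (\<Sum>k\<le>n - m. gauss_term \<alpha> 1 k) / (gbinom (real n + \<alpha>) \<alpha>)\<^sup>2"
proof -
  have "(\<Sum>j\<in>{Suc m..Suc n}. (cmod (complex_of_real (cesaro_coeff \<alpha> n j)
        - complex_of_real (cesaro_coeff \<alpha> n (j - 1))))\<^sup>2)
      = (\<Sum>k\<le>n - m. gauss_term \<alpha> 1 k / (gbinom (real n + \<alpha>) \<alpha>)\<^sup>2)"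
  proof (rule sum.reindex_bij_witness[of _ "\<lambda>k. Suc n - k" "\<lambda>j. Suc n - j"])
    fix j assume j: "j \<in> {Suc m..Suc n}"
    then have "j = Suc n - (Suc n - j)" "j - 1 = n - (Suc n - j)" "Suc n - j \<le> n" by auto
    then have "cesaro_coeff \<alpha> n j - cesaro_coeff \<alpha> n (j - 1)
        = - (pochhammer \<alpha> (Suc n - j) / fact (Suc n - j)) / gbinom (real n + \<alpha>) \<alpha>"
      using cesaro_coeff_diff[OF assms(1), of "Suc n - j" n] by metis
    then show "gauss_term \<alpha> 1 (Suc n - j) / (gbinom (real n + \<alpha>) \<alpha>)\<^sup>2
        = (cmod (complex_of_real (cesaro_coeff \<alpha> n j)
          - complex_of_real (cesaro_coeff \<alpha> n (j - 1))))\<^sup>2"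
      by (simp only: gauss_term_one power_divide power2_minus norm_of_real power2_abs flip: of_real_diff)
  qed (use assms in auto)
  then show ?thesis by (simp add: sum_divide_distrib)
qed

section \<open>Two-sided bounds for the norm and its asymptotics\<close>

lemma cesaro_norm_le:
  assumes "\<alpha> \<ge> 0" "\<alpha> < 1 / 2"
  shows "cesaro_norm \<alpha> n
    \<le> 1 + sqrt (real n * suminf (gauss_term \<alpha> 1)) / gbinom (real n + \<alpha>) \<alpha>"
proof -
  have "cesaro_norm \<alpha> n \<le> 1 + sqrt (real n * (\<Sum>j\<in>{1..Suc n}.
      (cmod (complex_of_real (cesaro_coeff \<alpha> n j) - complex_of_real (cesaro_coeff \<alpha> n (j - 1))))\<^sup>2))"
    unfolding cesaro_norm_def
    by (rule ell2_opnorm_T_matrix_le)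
      (use cesaro_coeff_le_one[OF assms(1)] in \<open>auto simp: cesaro_coeff_def[of _ _ k for k]\<close>)
  also have "\<dots> = 1 + sqrt (real n * ((\<Sum>k\<le>n. gauss_term \<alpha> 1 k) / (gbinom (real n + \<alpha>) \<alpha>)\<^sup>2))"
    using sum_cesaro_coeff_diff[OF assms(1), of 0 n] by simp
  also have "\<dots> = 1 + sqrt (real n * (\<Sum>k\<le>n. gauss_term \<alpha> 1 k)) / gbinom (real n + \<alpha>) \<alpha>"
    using gbinom_pos[OF assms(1), of n] by (simp add: real_sqrt_divide)
  also have "\<dots> \<le> 1 + sqrt (real n * suminf (gauss_term \<alpha> 1)) / gbinom (real n + \<alpha>) \<alpha>"
    using gbinom_pos[OF assms(1), of n] summable_gauss_term_one[OF assms(2)]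
    by (intro add_left_mono divide_right_mono real_sqrt_le_mono mult_left_mono sum_le_suminf)
      (auto simp: gauss_term_nonneg)
  finally show ?thesis .
qed

lemma cesaro_norm_ge:
  assumes "\<alpha> \<ge> 0" "M \<le> n"
  shows "sqrt (real (n - M) * (\<Sum>k\<le>M. gauss_term \<alpha> 1 k)) / gbinom (real n + \<alpha>) \<alpha>
    \<le> cesaro_norm \<alpha> n"
proof -
  have "sqrt (real (n - M) * (\<Sum>k\<le>M. gauss_term \<alpha> 1 k)) / gbinom (real n + \<alpha>) \<alpha>
      = sqrt (real (n - M) * ((\<Sum>k\<le>M. gauss_term \<alpha> 1 k) / (gbinom (real n + \<alpha>) \<alpha>)\<^sup>2))"
    using gbinom_pos[OF assms(1), of n] by (simp add: real_sqrt_divide)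
  also have "\<dots> = sqrt (real (n - M) * (\<Sum>j\<in>{Suc (n - M)..Suc n}.
      (cmod (complex_of_real (cesaro_coeff \<alpha> n j) - complex_of_real (cesaro_coeff \<alpha> n (j - 1))))\<^sup>2))"
    using sum_cesaro_coeff_diff[OF assms(1), of "n - M" n] assms(2) by simp
  also have "\<dots> \<le> cesaro_norm \<alpha> n"
    unfolding cesaro_norm_def
    by (rule ell2_opnorm_T_matrix_ge) (auto simp: cesaro_coeff_def)
  finally show ?thesis .
qed

lemma gbinom_LIMSEQ:
  assumes "\<alpha> \<ge> 0"
  shows "(\<lambda>n. gbinom (real n + \<alpha>) \<alpha> / real n powr \<alpha>) \<longlonglongrightarrow> inverse (Gamma (\<alpha> + 1))"
  using pochhammer_over_fact_LIMSEQ[of "\<alpha> + 1"]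
  unfolding gbinom_pochhammer[OF assms]
  by (simp add: powr_minus_divide rGamma_inverse_Gamma)

lemma cesaro_norm_LIMSEQ:
  assumes "\<alpha> \<ge> 0" "\<alpha> < 1 / 2"
  shows "(\<lambda>n. cesaro_norm \<alpha> n * gbinom (real n + \<alpha>) \<alpha> / sqrt (real n))
    \<longlonglongrightarrow> sqrt (suminf (gauss_term \<alpha> 1))"
proof (rule tendsto_sandwich)
  define F where "F = suminf (gauss_term \<alpha> 1)"
  \<comment> \<open>\<open>M\<close> must tend to infinity so that the partial sums exhaust the
    series, while M/n must tend to 0 so that few rows are lost; the square root does both.\<close>
  define M where "M n = nat \<lfloor>sqrt (real n)\<rfloor>" for n
  have M_le: "M n \<le> n" for n
  proof -
    have "sqrt (real n) \<le> real n"
      by (cases "n = 0") (auto intro: sqrt_le_D simp: real_le_lsqrt power2_eq_square)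
    then show ?thesis unfolding M_def by linarith
  qed
  show "\<forall>\<^sub>F n in sequentially.
      sqrt (real (n - M n) / real n * (\<Sum>k\<le>M n. gauss_term \<alpha> 1 k))
      \<le> cesaro_norm \<alpha> n * gbinom (real n + \<alpha>) \<alpha> / sqrt (real n)"
    using eventually_gt_at_top[of 0]
  proof eventually_elim
    case (elim n)
    show ?case
      using cesaro_norm_ge[OF assms(1) M_le, of n] gbinom_pos[OF assms(1), of n] elim
      by (simp add: real_sqrt_divide real_sqrt_mult divide_le_eq divide_right_mono)
  qed
  show "\<forall>\<^sub>F n in sequentially. cesaro_norm \<alpha> n * gbinom (real n + \<alpha>) \<alpha> / sqrt (real n)
      \<le> gbinom (real n + \<alpha>) \<alpha> / real n powr \<alpha> * real n powr (\<alpha> - 1 / 2) + sqrt F"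
    using eventually_gt_at_top[of 0]
  proof eventually_elim
    case (elim n)
    have "cesaro_norm \<alpha> n * gbinom (real n + \<alpha>) \<alpha> / sqrt (real n)
        \<le> (1 + sqrt (real n * F) / gbinom (real n + \<alpha>) \<alpha>) * gbinom (real n + \<alpha>) \<alpha> / sqrt (real n)"
      using cesaro_norm_le[OF assms, of n] gbinom_pos[OF assms(1), of n] unfolding F_def
      by (intro divide_right_mono mult_right_mono) auto
    \<comment> \<open>The first summand stems from the diagonal; it is of order n^(\<alpha> - 1/2)
      and tends to 0 as \<alpha> < 1/2.\<close>
    also have "\<dots> = gbinom (real n + \<alpha>) \<alpha> / sqrt (real n) + sqrt F"
      using gbinom_pos[OF assms(1), of n] elim by (simp add: real_sqrt_mult field_simps)
    also have "gbinom (real n + \<alpha>) \<alpha> / sqrt (real n)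
        = gbinom (real n + \<alpha>) \<alpha> / real n powr \<alpha> * real n powr (\<alpha> - 1 / 2)"
      using elim by (simp add: powr_diff powr_half_sqrt)
    finally show ?case .
  qed
  have "(\<lambda>n. real n powr (\<alpha> - 1 / 2)) \<longlonglongrightarrow> 0"
    using assms by real_asymp
  then have "(\<lambda>n. gbinom (real n + \<alpha>) \<alpha> / real n powr \<alpha> * real n powr (\<alpha> - 1 / 2) + sqrt F)
      \<longlonglongrightarrow> inverse (Gamma (\<alpha> + 1)) * 0 + sqrt F"
    by (intro tendsto_intros gbinom_LIMSEQ assms)
  then show "(\<lambda>n. gbinom (real n + \<alpha>) \<alpha> / real n powr \<alpha> * real n powr (\<alpha> - 1 / 2) + sqrt F)
      \<longlonglongrightarrow> sqrt (suminf (gauss_term \<alpha> 1))"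
    by (simp add: F_def)
  have "filterlim M at_top sequentially"
    unfolding M_def by real_asymp
  then have "(\<lambda>n. \<Sum>k\<le>M n. gauss_term \<alpha> 1 k) \<longlonglongrightarrow> F"
    using summable_LIMSEQ'[OF summable_gauss_term_one[OF assms(2)]] unfolding F_def
    by (rule filterlim_compose[rotated])
  moreover have "(\<lambda>n. real (n - M n) / real n) \<longlonglongrightarrow> 1"
  proof -
    have "(\<lambda>n. (real n - real (M n)) / real n) \<longlonglongrightarrow> 1"
      unfolding M_def by real_asymp
    then show ?thesis using M_le by (simp add: of_nat_diff)
  qed
  ultimately have "(\<lambda>n. sqrt (real (n - M n) / real n * (\<Sum>k\<le>M n. gauss_term \<alpha> 1 k)))
      \<longlonglongrightarrow> sqrt (1 * F)"
    by (intro tendsto_intros)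
  then show "(\<lambda>n. sqrt (real (n - M n) / real n * (\<Sum>k\<le>M n. gauss_term \<alpha> 1 k)))
      \<longlonglongrightarrow> sqrt (suminf (gauss_term \<alpha> 1))"
    by (simp add: F_def)
qed

theorem theorem3p1:
  fixes \<alpha> :: real
  assumes "\<alpha> \<in> {0..1}" and "\<alpha> < 1 / 2"
  shows "C_const \<alpha> > 0 \<and>
    (\<lambda>n. cesaro_norm \<alpha> n) \<sim>[sequentially] (\<lambda>n. C_const \<alpha> * real n powr (1 / 2 - \<alpha>))"
proof -
  have \<alpha>: "\<alpha> \<ge> 0" using assms by simp
  have pos: "Gamma (\<alpha> + 1) > 0" "Gamma (1 - 2 * \<alpha>) > 0" "Gamma (1 - \<alpha>) > 0"
    using assms by (auto intro!: Gamma_real_pos)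
  then have C_pos: "C_const \<alpha> > 0"
    by (simp add: C_const_def)
  have C: "C_const \<alpha> = Gamma (\<alpha> + 1) * sqrt (suminf (gauss_term \<alpha> 1))"
    using pos
    by (simp add: C_const_def suminf_gauss_term_one[OF assms(2)] real_sqrt_divide powr_half_sqrt)
  \<comment> \<open>Dividing the limit for the norm by the limit for the binomial cancels
    \<open>gbinom\<close> and leaves the power n^(1/2 - \<alpha>).\<close>
  have "(\<lambda>n. (cesaro_norm \<alpha> n * gbinom (real n + \<alpha>) \<alpha> / sqrt (real n))
        / (gbinom (real n + \<alpha>) \<alpha> / real n powr \<alpha>) / C_const \<alpha>)
      \<longlonglongrightarrow> sqrt (suminf (gauss_term \<alpha> 1)) / inverse (Gamma (\<alpha> + 1)) / C_const \<alpha>"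
    using pos C_pos by (intro tendsto_intros cesaro_norm_LIMSEQ gbinom_LIMSEQ \<alpha> assms) auto
  also have "sqrt (suminf (gauss_term \<alpha> 1)) / inverse (Gamma (\<alpha> + 1)) = C_const \<alpha>"
    by (simp add: C divide_inverse mult.commute)
  also have "C_const \<alpha> / C_const \<alpha> = 1"
    using C_pos by simp
  finally have "(\<lambda>n. cesaro_norm \<alpha> n / (C_const \<alpha> * real n powr (1 / 2 - \<alpha>))) \<longlonglongrightarrow> 1"
  proof (rule Lim_transform_eventually)
    show "\<forall>\<^sub>F n in sequentially. (cesaro_norm \<alpha> n * gbinom (real n + \<alpha>) \<alpha> / sqrt (real n))
        / (gbinom (real n + \<alpha>) \<alpha> / real n powr \<alpha>) / C_const \<alpha>
        = cesaro_norm \<alpha> n / (C_const \<alpha> * real n powr (1 / 2 - \<alpha>))"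
      using eventually_gt_at_top[of 0]
    proof eventually_elim
      case (elim n)
      have "real n powr (1 / 2 - \<alpha>) = sqrt (real n) / real n powr \<alpha>"
        using elim by (simp add: powr_diff powr_half_sqrt)
      then show ?case
        using gbinom_pos[OF \<alpha>, of n] C_pos elim by simp
    qed
  qed
  then show ?thesis
    using C_pos by (auto intro: asymp_equivI')
qed

end
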